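(* Let $n \geq 1$ be an integer, let $j = 4n+1$, and let $k$ be an even positive integer with $k \leq j(j-1)/2$ and $D=\{1,j,k\}$. Write $k = m(j+1) + \overline{k}$ with integers $m \geq 0$ and $0 \leq \overline{k} \leq j$. Then \[ \kappa(D) = \mu(D) = \begin{cases} \frac{n}{2n+1} & \text{if } \overline{k} = 2n \text{ or } \overline{k} = 2n+2,\\[2pt] \frac{k-2m}{2(k+1)} & \text{if } \max\{0, 2(n-m)\} \leq \overline{k} \leq 2(n-1). \end{cases} \]
   Context: For a set $D$ of positive integers, a $D$-sequence is a set $S$ of nonnegative integers such that $|x-y| \notin D$ for all $x,y \in S$. For $N \geq 0$ write $S[N] = |S \cap \{0,1,\dots,N\}|$. The upper and lower densities of $S$ are $\limsup_{N\to\infty} S[N]/(N+1)$ and $\liminf_{N\to\infty} S[N]/(N+1)$; if they coincide, the common value is the density $\delta(S)$. Define $\mu(D) = \sup\{\delta(S) : S \text{ is a } D\text{-sequence having a density}\}$. For a real $x$, $\|x\|$ denotes the distance from $x$ to the nearest integer, and $\kappa(D) = \sup_{t \in \mathbb{R}} \min_{d \in D} \|td\|$. *)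

theory Defs
  imports "HOL-Analysis.Analysis"
begin

definition is_D_sequence :: "nat set \<Rightarrow> nat set \<Rightarrow> bool" where
  "is_D_sequence D S \<longleftrightarrow> (\<forall>x\<in>S. \<forall>y\<in>S. nat \<bar>int x - int y\<bar> \<notin> D)"

definition count_upto :: "nat set \<Rightarrow> nat \<Rightarrow> nat" where
  "count_upto S N = card (S \<inter> {0..N})"

definition upper_dens :: "nat set \<Rightarrow> ereal" where
  "upper_dens S = limsup (\<lambda>N. ereal (real (count_upto S N) / (real N + 1)))"

definition lower_dens :: "nat set \<Rightarrow> ereal" where
  "lower_dens S = liminf (\<lambda>N. ereal (real (count_upto S N) / (real N + 1)))"

definition has_dens :: "nat set \<Rightarrow> bool" where
  "has_dens S \<longleftrightarrow> upper_dens S = lower_dens S"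

(* Meaningful only when has_dens S holds; the ratios lie in [0,1], so the conversion
   from ereal loses nothing. *)
definition dens :: "nat set \<Rightarrow> real" where
  "dens S = real_of_ereal (upper_dens S)"

(* The empty set is a D-sequence of density 0 and all densities lie in [0,1], so this
   supremum of reals is always a genuine one. *)
definition mu :: "nat set \<Rightarrow> real" where
  "mu D = Sup {dens S | S. is_D_sequence D S \<and> has_dens S}"

definition int_dist :: "real \<Rightarrow> real" where
  "int_dist x = \<bar>x - of_int (round x)\<bar>"

(* Intended for finite nonempty D, where the minimum exists. *)
definition kappa :: "nat set \<Rightarrow> real" where
  "kappa D = (SUP t::real. Min ((\<lambda>d. int_dist (t * real d)) ` D))"

end

theory Submission
  imports Defs
begin

text \<open>
  Call a window \<open>[y, y + j]\<close> full if it contains \<open>(j + 1) / 2\<close> elements of the \<open>D\<close>-sequence \<open>S\<close>; since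
  the differences \<open>1\<close> and \<open>j\<close> are forbidden, \<open>S\<close> then alternates on it. The main point is that a
  full window at \<open>y \<in> [x, x + k]\<close> with \<open>y - x\<close> even forces \<open>S\<close> to have at most \<open>k / 2\<close> elements in
  \<open>[x, x + k + j)\<close>. This is a matching argument: with \<open>\<pi>\<close> the parity class of \<open>S\<close> in the full window,
  pair \<open>i\<close> with \<open>i + j\<close> for \<open>i \<notin> \<pi>\<close> in \<open>[x, y)\<close> and for \<open>i \<in> \<pi>\<close> in \<open>[y, x + k)\<close>, and pair \<open>i\<close> with
  \<open>i + k\<close> for \<open>i \<in> \<pi>\<close> in \<open>[x, x + j)\<close>; elements of \<open>\<pi>\<close> in the full window are then counted twice.

  Hence every \<open>x\<close> starts a block on which \<open>S\<close> has at most the claimed density \<open>\<alpha>\<close>. In the first case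
  take length \<open>j + 1\<close> if the window at \<open>x\<close> is not full and \<open>k + j\<close> otherwise. In the second case take
  length \<open>1\<close> if \<open>x \<notin> S\<close>; if \<open>x \<in> S\<close>, then \<open>x + k \<notin> S\<close>, so either \<open>[x, x + k]\<close> is sparse enough or one of
  its \<open>m\<close> consecutive windows of length \<open>j + 1\<close> is full and length \<open>k + j\<close> works. Concatenating blocks
  gives \<open>|S \<inter> [0, N)| \<le> \<alpha> N + O(1)\<close>, hence \<open>\<mu> \<le> \<alpha>\<close>; averaging this bound over rotations
  of the circle by \<open>t\<close> gives \<open>\<kappa> \<le> \<alpha>\<close>. Both bounds are attained with \<open>t = a / M = \<alpha>\<close> itself,
  for \<open>\<mu>\<close> by the set of \<open>i\<close> with \<open>a i mod M < a\<close>.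
\<close>

section \<open>Full windows and the matching bound\<close>

text \<open>The slacks \<open>1 - f i - f (i + 1)\<close> are nonnegative, and over the window they
  add up to \<open>j\<close> minus twice the window sum plus \<open>f y + f (y + j)\<close>, hence
  to at most 0; so each vanishes.\<close>

lemma alternating_if_full:
  fixes f :: "nat \<Rightarrow> int"
  assumes succ: "\<And>i. f i + f (i + 1) \<le> 1" and ends: "f y + f (y + j) \<le> 1"
    and full: "(\<Sum>i = y..<y + (j + 1). f i) * 2 \<ge> int j + 1"
    and i: "y \<le> i" "i < y + j"
  shows "f (i + 1) = 1 - f i"
proof -
  have "(\<Sum>i = y..<y + j. f (i + 1)) = (\<Sum>i = y + 1..<y + j + 1. f i)"
    using sum.shift_bounds_nat_ivl[of f y 1 "y + j"] by (simp add: add.assoc)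
  then have "(\<Sum>i = y..<y + j. 1 - f i - f (i + 1))
      = int j - (\<Sum>i = y..<y + j. f i) - (\<Sum>i = y + 1..<y + j + 1. f i)"
    by (simp add: sum_subtractf)
  moreover have "(\<Sum>i = y..<y + (j + 1). f i) = (\<Sum>i = y..<y + j. f i) + f (y + j)"
    by simp
  moreover have "(\<Sum>i = y..<y + (j + 1). f i) = f y + (\<Sum>i = y + 1..<y + j + 1. f i)"
    by (simp add: sum.atLeast_Suc_lessThan)
  ultimately have "(\<Sum>i = y..<y + j. 1 - f i - f (i + 1)) \<le> 0"
    using ends full by linarith
  moreover have nn: "\<And>i. i \<in> {y..<y + j} \<Longrightarrow> 0 \<le> 1 - f i - f (i + 1)"
    using succ by (smt (verit))
  ultimately have "(\<Sum>i = y..<y + j. 1 - f i - f (i + 1)) = 0"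
    by (meson order_antisym sum_nonneg)
  then have "\<forall>i\<in>{y..<y + j}. 1 - f i - f (i + 1) = 0"
    using sum_nonneg_eq_0_iff[of "{y..<y + j}" "\<lambda>i. 1 - f i - f (i + 1)"] nn by blast
  then show ?thesis using i by fastforce
qed

lemma parity_class_if_full:
  fixes f :: "nat \<Rightarrow> int"
  assumes rng: "\<And>i. f i \<in> {0, 1}"
    and succ: "\<And>i. f i + f (i + 1) \<le> 1" and ends: "f y + f (y + j) \<le> 1"
    and full: "(\<Sum>i = y..<y + (j + 1). f i) * 2 \<ge> int j + 1"
  obtains e where "\<And>i. \<lbrakk>y \<le> i; i \<le> y + j\<rbrakk> \<Longrightarrow> f i = of_bool (even (i + e))"
proof -
  define e where "e = (if f y = 1 then y else y + 1)"
  have "f (y + t) = of_bool (even (y + t + e))" if "t \<le> j" for t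
    using that
  proof (induction t)
    case 0
    show ?case using rng[of y] by (auto simp: e_def)
  next
    case (Suc t)
    then have "f (y + t + 1) = 1 - f (y + t)"
      by (intro alternating_if_full[OF succ ends full]) auto
    with Suc show ?case by auto
  qed
  then show ?thesis
    by (intro that[of e]) (metis le_add_diff_inverse nat_add_left_cancel_le)
qed

lemma sum_parity_class:
  "(\<Sum>i = a..<a + 2 * t. of_bool (even (i + e))) = int t"
  by (induction t) auto

lemma sum_parity_class_shift:
  fixes a b e s :: nat
  assumes "even s"
  shows "(\<Sum>i = a + s..<b + s. of_bool (even (i + e)) :: int) = (\<Sum>i = a..<b. of_bool (even (i + e)))"
  using sum.shift_bounds_nat_ivl[of "\<lambda>i. of_bool (even (i + e)) :: int" a s b] assms
  by (simp del: sum_of_bool_eq)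

text \<open>The three pairings give the bounds \<open>r\<close>, \<open>t\<close> and the sum of
  \<open>w\<close> over \<open>[x, x + j)\<close>. Their left sides add up to the whole count plus
  \<open>P y (y + j)\<close>, which equals the third bound because \<open>y - x\<close> is even.
  What remains is \<open>t + r = k / 2\<close>.\<close>

lemma sum_le_half_if_full:
  fixes f :: "nat \<Rightarrow> int"
  assumes rng: "\<And>i. f i \<in> {0, 1}"
    and d1: "\<And>i. f i + f (i + 1) \<le> 1" and dj: "\<And>i. f i + f (i + j) \<le> 1"
    and dk: "\<And>i. f i + f (i + k) \<le> 1"
    and "odd j" "even k" and xy: "x \<le> y" "y \<le> x + k" "even (y - x)"
    and full: "(\<Sum>i = y..<y + (j + 1). f i) * 2 \<ge> int j + 1"
  shows "2 * (\<Sum>i = x..<x + (k + j). f i) \<le> int k"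
proof -
  obtain e where e: "\<And>i. \<lbrakk>y \<le> i; i \<le> y + j\<rbrakk> \<Longrightarrow> f i = of_bool (even (i + e))"
    using parity_class_if_full[OF rng d1 dj full] by metis
  \<comment> \<open>\<open>w\<close> marks the parity class of the full window; \<open>P\<close> and
    \<open>P'\<close> count inside and outside it. The odd shift \<open>j\<close> exchanges the
    classes, the even shift \<open>k\<close> preserves them.\<close>
  define w :: "nat \<Rightarrow> int" where "w i = of_bool (even (i + e))" for i
  define P where "P a b = (\<Sum>i = a..<b. w i * f i)" for a b
  define P' where "P' a b = (\<Sum>i = a..<b. (1 - w i) * f i)" for a b
  have wj: "w (i + j) = 1 - w i" for i using \<open>odd j\<close> by (auto simp: w_def)
  have wk: "w (i + k) = w i" for i using \<open>even k\<close> by (auto simp: w_def)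
  have w01: "0 \<le> w i" "w i \<le> 1" for i by (auto simp: w_def)
  have cat: "P a b + P b c = P a c" "P' a b + P' b c = P' a c" if "a \<le> b" "b \<le> c" for a b c
    using that by (auto simp: P_def P'_def sum.atLeastLessThan_concat)
  have split: "(\<Sum>i = a..<b. f i) = P a b + P' a b" for a b
    by (simp add: P_def P'_def flip: sum.distrib distrib_right)
  obtain t where t: "y = x + 2 * t" using xy by (metis evenE le_add_diff_inverse)
  obtain r where r: "x + k = y + 2 * r"
  proof -
    have "even (x + k - y)" using xy t \<open>even k\<close> by simp
    then show ?thesis using xy that by (metis evenE le_add_diff_inverse)
  qed
  have "P y (x + k) + P' (y + j) (x + k + j) \<le> int r"
  proof -
    have "P' (y + j) (x + k + j) = (\<Sum>i = y..<x + k. w i * f (i + j))"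
      by (simp add: P'_def sum.shift_bounds_nat_ivl wj)
    then have "P y (x + k) + P' (y + j) (x + k + j) = (\<Sum>i = y..<x + k. w i * (f i + f (i + j)))"
      by (simp add: P_def sum.distrib distrib_left)
    also have "\<dots> \<le> (\<Sum>i = y..<x + k. w i * 1)"
      by (intro sum_mono mult_left_mono dj w01)
    also have "\<dots> = int r" unfolding r w_def mult_1_right by (rule sum_parity_class)
    finally show ?thesis .
  qed
  moreover have "P' x y + P (x + j) (y + j) \<le> int t"
  proof -
    have "P (x + j) (y + j) = (\<Sum>i = x..<y. (1 - w i) * f (i + j))"
      by (simp add: P_def sum.shift_bounds_nat_ivl wj)
    then have "P' x y + P (x + j) (y + j) = (\<Sum>i = x..<y. (1 - w i) * (f i + f (i + j)))"
      by (simp add: P'_def sum.distrib distrib_left)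
    also have "\<dots> \<le> (\<Sum>i = x..<y. (1 - w i) * 1)"
      by (intro sum_mono mult_left_mono dj) (use w01 in auto)
    also have "\<dots> = int (2 * t) - (\<Sum>i = x..<y. w i)" by (simp add: sum_subtractf t)
    also have "(\<Sum>i = x..<y. w i) = int t" unfolding t w_def by (rule sum_parity_class)
    finally show ?thesis by simp
  qed
  moreover have "P x (x + j) + P (x + k) (x + k + j) \<le> (\<Sum>i = x..<x + j. w i)"
  proof -
    have "P (x + k) (x + k + j) = (\<Sum>i = x..<x + j. w i * f (i + k))"
      using sum.shift_bounds_nat_ivl[of "\<lambda>i. w i * f i" x k "x + j"]
      by (simp add: P_def wk ac_simps)
    then have "P x (x + j) + P (x + k) (x + k + j) = (\<Sum>i = x..<x + j. w i * (f i + f (i + k)))"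
      by (simp add: P_def sum.distrib distrib_left)
    also have "\<dots> \<le> (\<Sum>i = x..<x + j. w i * 1)"
      by (intro sum_mono mult_left_mono dk w01)
    finally show ?thesis by simp
  qed
  moreover have "P y (y + j) = (\<Sum>i = x..<x + j. w i)"
  proof -
    have "P y (y + j) = (\<Sum>i = y..<y + j. w i)"
      unfolding P_def by (intro sum.cong) (auto simp: e w_def)
    also have "\<dots> = (\<Sum>i = x..<x + j. w i)"
      using sum_parity_class_shift[where s = "2 * t" and a = x and b = "x + j" and e = e]
      by (simp add: t w_def ac_simps del: sum_of_bool_eq)
    finally show ?thesis .
  qed
  moreover have "P' y (y + j) = 0"
    unfolding P'_def by (intro sum.neutral) (auto simp: e w_def)
  \<comment> \<open>\<open>[x, y + j)\<close> is cut at \<open>x + j\<close>, as the pairings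
    require, and at \<open>y\<close>, which isolates the full window.\<close>
  moreover have "P x (x + j) + P (x + j) (y + j) = P x y + P y (y + j)"
    using cat(1)[of x "x + j" "y + j"] cat(1)[of x y "y + j"] xy by simp
  moreover have "(\<Sum>i = x..<x + (k + j). f i)
      = P x y + P y (x + k) + P (x + k) (x + k + j) + P' x y + P' y (y + j) + P' (y + j) (x + k + j)"
    using cat(1)[of x y "x + k"] cat(1)[of x "x + k" "x + k + j"] cat(2)[of x y "y + j"]
      cat(2)[of x "y + j" "x + k + j"] xy by (simp add: split add.assoc)
  moreover have "int k = 2 * int t + 2 * int r" using r t by simp
  ultimately show ?thesis by linarith
qed

section \<open>Counting bounds and densities\<close>

text \<open>Blocks are stripped from the left until a piece of length at most \<open>L\<close> is
  left, which costs at most \<open>L\<close>. The uniform bound on \<open>l\<close> keeps the error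
  independent of \<open>N\<close>.\<close>

lemma sum_le_if_everywhere_sparse_block:
  fixes f :: "nat \<Rightarrow> int" and \<alpha> :: real
  assumes "0 \<le> \<alpha>" and f1: "\<And>i. f i \<le> 1"
    and block: "\<And>x. \<exists>l. 0 < l \<and> l \<le> L \<and> real_of_int (\<Sum>i = x..<x + l. f i) \<le> \<alpha> * real l"
  shows "real_of_int (\<Sum>i = x..<x + N. f i) \<le> \<alpha> * real N + real L"
proof (induction N arbitrary: x rule: less_induct)
  case (less N)
  show ?case
  proof (cases "N \<le> L")
    case True
    have "(\<Sum>i = x..<x + N. f i) \<le> (\<Sum>i = x..<x + N. 1)" by (intro sum_mono f1)
    then have "real_of_int (\<Sum>i = x..<x + N. f i) \<le> real_of_int (int N)"
      by (subst of_int_le_iff) simp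
    also have "\<dots> \<le> \<alpha> * real N + real L" using True \<open>0 \<le> \<alpha>\<close> by (simp add: add_increasing)
    finally show ?thesis .
  next
    case False
    obtain l where l: "0 < l" "l \<le> L" "real_of_int (\<Sum>i = x..<x + l. f i) \<le> \<alpha> * real l"
      using block by blast
    have "(\<Sum>i = x..<x + N. f i) = (\<Sum>i = x..<x + l. f i) + (\<Sum>i = x + l..<x + l + (N - l). f i)"
      using l False by (simp add: sum.atLeastLessThan_concat)
    moreover have "real_of_int (\<Sum>i = x + l..<x + l + (N - l). f i) \<le> \<alpha> * real (N - l) + real L"
      using l False by (intro less.IH) auto
    moreover have "\<alpha> * real l + \<alpha> * real (N - l) = \<alpha> * real N"
      using l False by (simp flip: distrib_left of_nat_add)
    ultimately show ?thesis using l(3) by simp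
  qed
qed

lemma dens_le_if_count_le:
  assumes "\<And>N. real (count_upto S N) \<le> \<alpha> * (real N + 1) + C"
  shows "dens S \<le> \<alpha>"
proof -
  have "upper_dens S \<le> limsup (\<lambda>N. ereal (\<alpha> + C / (real N + 1)))"
    unfolding upper_dens_def
  proof (intro Limsup_mono always_eventually allI)
    fix N
    have "real (count_upto S N) / (real N + 1) \<le> (\<alpha> * (real N + 1) + C) / (real N + 1)"
      by (intro divide_right_mono assms) simp
    also have "\<dots> = \<alpha> + C / (real N + 1)" by (simp add: add_divide_distrib)
    finally show "ereal (real (count_upto S N) / (real N + 1)) \<le> ereal (\<alpha> + C / (real N + 1))"
      by simp
  qed
  also have "\<dots> = ereal \<alpha>"
  proof (intro lim_imp_Limsup)
    have "(\<lambda>N. \<alpha> + C * inverse (real (Suc N))) \<longlonglongrightarrow> \<alpha> + C * 0"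
      by (intro tendsto_intros LIMSEQ_inverse_real_of_nat)
    then show "(\<lambda>N. ereal (\<alpha> + C / (real N + 1))) \<longlonglongrightarrow> ereal \<alpha>"
      by (simp add: divide_inverse add.commute)
  qed simp
  finally have "upper_dens S \<le> ereal \<alpha>" .
  \<comment> \<open>\<open>real_of_ereal\<close> is 0 at infinite values, so
    \<open>-\<infinity>\<close> has to be excluded: there the claim would fail for negative
    \<open>\<alpha>\<close>.\<close>
  moreover have "0 \<le> upper_dens S"
    unfolding upper_dens_def
    by (rule order_trans[OF _ Liminf_le_Limsup])
       (auto intro!: Liminf_bounded always_eventually)
  ultimately show ?thesis
    unfolding dens_def by (cases "upper_dens S") auto
qed

text \<open>The condition \<open>a i mod M < a\<close> says exactly that \<open>\<lfloor>a i / M\<rfloor>\<close> exceeds \<open>\<lfloor>a (i - 1) / M\<rfloor>\<close>, so the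
  count telescopes and no coprimality of \<open>a\<close> and \<open>M\<close> is needed.\<close>

lemma count_upto_beatty:
  assumes "a \<le> M" "0 < a"
  shows "count_upto {i. a * i mod M < a} N = a * N div M + 1"
proof (induction N)
  case 0
  \<comment> \<open>Index 0 always belongs to the set, whence the \<open>+ 1\<close>.\<close>
  have "{i. a * i mod M < a} \<inter> {0..0} = {0}" using assms by auto
  then show ?case by (simp add: count_upto_def)
next
  case (Suc N)
  let ?S = "{i. a * i mod M < a}"
  have "count_upto ?S (Suc N) = count_upto ?S N + of_bool (Suc N \<in> ?S)"
  proof -
    have "?S \<inter> {0..Suc N} = (?S \<inter> {0..N}) \<union> (if Suc N \<in> ?S then {Suc N} else {})"
      by (auto simp: le_Suc_eq)
    then show ?thesis by (auto simp: count_upto_def)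
  qed
  moreover have "a * Suc N div M = a * N div M + of_bool (a * Suc N mod M < a)"
  proof -
    define q r where "q = a * N div M" and "r = a * N mod M"
    have qr: "a * N = q * M + r" "r < M" using assms by (auto simp: q_def r_def)
    have *: "a * Suc N = q * M + (r + a)" using qr by simp
    show ?thesis
    \<comment> \<open>As \<open>a \<le> M\<close>, adding \<open>a\<close> carries at most once; a
      carry leaves a residue below \<open>a\<close>, no carry leaves one that is at least
      \<open>a\<close>.\<close>
    proof (cases "r + a < M")
      case True
      then have "a * Suc N div M = q" "a * Suc N mod M = r + a" unfolding * by auto
      then show ?thesis by (simp add: q_def)
    next
      case False
      then have "a * Suc N = (q + 1) * M + (r + a - M)" "r + a - M < M" "r + a - M < a"
        using * qr assms by auto
      then have "a * Suc N div M = q + 1" "a * Suc N mod M = r + a - M"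
        by (simp_all only: div_mult_self3 mod_mult_self3 div_less mod_less)
      then show ?thesis using \<open>r + a - M < a\<close> by (simp add: q_def)
    qed
  qed
  ultimately show ?case using Suc by simp
qed

lemma dens_beatty:
  assumes "a \<le> M" "0 < a"
  shows "has_dens {i. a * i mod M < a}" "dens {i. a * i mod M < a} = real a / real M"
proof -
  let ?S = "{i. a * i mod M < a}"
  have M: "real M > 0" using assms by simp
  have lim: "(\<lambda>N. real (count_upto ?S N) / (real N + 1)) \<longlonglongrightarrow> real a / real M"
  proof (rule tendsto_sandwich)
    have bounds: "real a * real N / real M - 1 \<le> real (a * N div M)"
      "real (a * N div M) \<le> real a * real N / real M" for N
    proof -
      have "a * N = a * N div M * M + a * N mod M" "a * N mod M < M" using assms by auto
      then have "real a * real N = real (a * N div M) * real M + real (a * N mod M)" "real (a * N mod M) < real M"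
        by (metis of_nat_add of_nat_mult, simp)
      then show "real a * real N / real M - 1 \<le> real (a * N div M)"
        "real (a * N div M) \<le> real a * real N / real M" using M by (simp_all add: field_simps)
    qed
    \<comment> \<open>The \<open>+ 1\<close> of the count makes up for the loss in the floor, so the
      lower bound needs no correction.\<close>
    show "\<forall>\<^sub>F N in sequentially. (real a * real N / real M) / (real N + 1)
        \<le> real (count_upto ?S N) / (real N + 1)"
      using bounds by (intro always_eventually allI divide_right_mono)
        (auto simp: count_upto_beatty[OF assms] diff_le_eq add.commute)
    show "\<forall>\<^sub>F N in sequentially. real (count_upto ?S N) / (real N + 1)
        \<le> (real a * real N / real M + 1) / (real N + 1)"
      using bounds by (intro always_eventually allI divide_right_mono)
        (auto simp: count_upto_beatty[OF assms] diff_le_eq add.commute)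
    have inv: "(\<lambda>N. inverse (real (Suc N))) \<longlonglongrightarrow> 0" by (rule LIMSEQ_inverse_real_of_nat)
    have "(\<lambda>N. real a / real M - real a / real M * inverse (real (Suc N)))
        \<longlonglongrightarrow> real a / real M - real a / real M * 0"
      by (intro tendsto_intros inv)
    also have "(\<lambda>N. real a / real M - real a / real M * inverse (real (Suc N)))
        = (\<lambda>N. (real a * real N / real M) / (real N + 1))"
    proof
      fix N :: nat
      define A where "A = real a / real M"
      have "real a * real N / real M = A * real N" by (simp add: A_def)
      then show "real a / real M - real a / real M * inverse (real (Suc N))
          = (real a * real N / real M) / (real N + 1)"
        unfolding A_def[symmetric] by (simp add: field_simps)
    qed
    finally show "(\<lambda>N. (real a * real N / real M) / (real N + 1)) \<longlonglongrightarrow> real a / real M" by simp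
    have "(\<lambda>N. real a / real M + (1 - real a / real M) * inverse (real (Suc N)))
        \<longlonglongrightarrow> real a / real M + (1 - real a / real M) * 0"
      by (intro tendsto_intros inv)
    also have "(\<lambda>N. real a / real M + (1 - real a / real M) * inverse (real (Suc N)))
        = (\<lambda>N. (real a * real N / real M + 1) / (real N + 1))"
    proof
      fix N :: nat
      define A where "A = real a / real M"
      have "real a * real N / real M = A * real N" by (simp add: A_def)
      then show "real a / real M + (1 - real a / real M) * inverse (real (Suc N))
          = (real a * real N / real M + 1) / (real N + 1)"
        unfolding A_def[symmetric] by (simp add: field_simps)
    qed
    finally show "(\<lambda>N. (real a * real N / real M + 1) / (real N + 1)) \<longlonglongrightarrow> real a / real M" by simp
  qed
  then have "(\<lambda>N. ereal (real (count_upto ?S N) / (real N + 1))) \<longlonglongrightarrow> ereal (real a / real M)" by simp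
  then have "upper_dens ?S = ereal (real a / real M)" "lower_dens ?S = ereal (real a / real M)"
    unfolding upper_dens_def lower_dens_def by (auto intro: lim_imp_Limsup lim_imp_Liminf)
  then show "has_dens ?S" "dens ?S = real a / real M" by (auto simp: has_dens_def dens_def)
qed

section \<open>D-sequences from residues and rotations\<close>

lemma is_D_sequenceI:
  assumes "\<And>i d. \<lbrakk>d \<in> D; i \<in> S; i + d \<in> S\<rbrakk> \<Longrightarrow> False"
  shows "is_D_sequence D S"
  unfolding is_D_sequence_def
proof (intro ballI notI)
  fix x y assume xy: "x \<in> S" "y \<in> S" "nat \<bar>int x - int y\<bar> \<in> D"
  show False
  proof (cases "x \<le> y")
    case True
    then have "nat \<bar>int x - int y\<bar> = y - x" by simp
    then show False using assms[of "y - x" x] xy True by simp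
  next
    case False
    then have "nat \<bar>int x - int y\<bar> = x - y" by simp
    then show False using assms[of "x - y" y] xy False by simp
  qed
qed

lemma is_D_sequenceD:
  assumes "is_D_sequence D S" "d \<in> D"
  shows "of_bool (i \<in> S) + of_bool (i + d \<in> S) \<le> (1 :: int)"
proof -
  have "nat \<bar>int i - int (i + d)\<bar> = d" by simp
  then have "\<not> (i \<in> S \<and> i + d \<in> S)" using assms unfolding is_D_sequence_def by metis
  then show ?thesis by auto
qed

text \<open>Residues in \<open>[0, a)\<close> differ by less than \<open>a\<close>, while
  \<open>gap\<close> keeps \<open>a * d\<close> at least \<open>a\<close> away from all multiples of
  \<open>M\<close>. In this integer form \<open>gap\<close> also yields the bound on
  \<open>int_dist\<close> for \<open>t = a / M\<close>.\<close>

lemma is_D_sequence_residue_interval: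
  assumes gap: "\<And>d z :: int. d \<in> int ` D \<Longrightarrow> int a \<le> \<bar>int a * d - z * int M\<bar>"
  shows "is_D_sequence D {i. a * i mod M < a}"
proof (rule is_D_sequenceI)
  fix i d assume "d \<in> D" and i: "i \<in> {i. a * i mod M < a}" "i + d \<in> {i. a * i mod M < a}"
  define r r' q q' where "r = int (a * i mod M)" and "r' = int (a * (i + d) mod M)"
    and "q = int (a * i div M)" and "q' = int (a * (i + d) div M)"
  have "int (a * i) = q * int M + r" "int (a * (i + d)) = q' * int M + r'"
    unfolding r_def r'_def q_def q'_def
    by (metis div_mult_mod_eq of_nat_add of_nat_mult)+
  then have "int a * int d - (q' - q) * int M = r' - r" by (simp add: algebra_simps)
  moreover have "\<bar>r' - r\<bar> < int a" using i unfolding r_def r'_def by auto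
  ultimately show False using gap[of "int d" "q' - q"] \<open>d \<in> D\<close> by auto
qed

lemma le_int_distI:
  assumes "\<And>z :: int. c \<le> \<bar>x - of_int z\<bar>"
  shows "c \<le> int_dist x"
  using assms unfolding int_dist_def by blast

lemma int_dist_le: "int_dist x \<le> \<bar>x - of_int z\<bar>"
  unfolding int_dist_def using round_diff_minimal[of x z] .

lemma int_dist_le_half: "int_dist x \<le> 1 / 2"
  unfolding int_dist_def using of_int_round_abs_le[of x] by (simp add: abs_minus_commute)


section \<open>Averaging over rotations\<close>

text \<open>Translation permutes the residues modulo \<open>Q\<close>. In the averaging, each index
  is therefore hit from exactly \<open>h\<close> of the \<open>Q\<close> starting points.\<close>

lemma card_residues_shift:
  fixes z :: int
  assumes "h \<le> Q"
  shows "card {q \<in> {0..<int Q}. (q + z) mod int Q < int h} = h"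
proof (cases "Q = 0")
  case False
  have "bij_betw (\<lambda>r. (r - z) mod int Q) {0..<int h} {q \<in> {0..<int Q}. (q + z) mod int Q < int h}"
  proof (rule bij_betw_byWitness[where f' = "\<lambda>q. (q + z) mod int Q"])
    show "\<forall>r\<in>{0..<int h}. ((r - z) mod int Q + z) mod int Q = r"
      using assms by (auto simp: mod_add_left_eq)
    show "\<forall>q\<in>{q \<in> {0..<int Q}. (q + z) mod int Q < int h}. ((q + z) mod int Q - z) mod int Q = q"
      by (auto simp: mod_diff_left_eq)
    show "(\<lambda>r. (r - z) mod int Q) ` {0..<int h} \<subseteq> {q \<in> {0..<int Q}. (q + z) mod int Q < int h}"
      using assms False by (auto simp: mod_add_left_eq)
    show "(\<lambda>q. (q + z) mod int Q) ` {q \<in> {0..<int Q}. (q + z) mod int Q < int h} \<subseteq> {0..<int h}"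
      using False by auto
  qed
  then show ?thesis using bij_betw_same_card by fastforce
qed (use assms in auto)

text \<open>A discretisation of the set of \<open>i\<close> with \<open>frac (q / Q + t i) < h / Q\<close>: replacing the arc by residues modulo
  \<open>Q\<close> makes averaging over the starting point \<open>q\<close> a finite count.\<close>

lemma is_D_sequence_rotation:
  fixes t :: real and q :: int
  assumes "0 < Q" and gap: "\<And>d. d \<in> D \<Longrightarrow> real h \<le> real Q * int_dist (t * real d)"
  shows "is_D_sequence D {i. (q + \<lfloor>real Q * t * real i\<rfloor>) mod int Q < int h}"
proof (rule is_D_sequenceI)
  fix i d
  let ?F = "\<lambda>i. q + \<lfloor>real Q * t * real i\<rfloor>"
  assume "d \<in> D" and i: "i \<in> {i. ?F i mod int Q < int h}" "i + d \<in> {i. ?F i mod int Q < int h}"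
  define v z where "v = ?F (i + d) mod int Q - ?F i mod int Q"
    and "z = ?F (i + d) div int Q - ?F i div int Q"
  have "?F (i + d) - ?F i = z * int Q + v"
    by (simp add: v_def z_def left_diff_distrib minus_mod_eq_mult_div algebra_simps)
  then have eq: "real_of_int \<lfloor>real Q * t * real (i + d)\<rfloor> - real_of_int \<lfloor>real Q * t * real i\<rfloor> = z * real Q + v"
    by (metis (no_types) add_diff_cancel_left of_int_add of_int_diff of_int_mult of_int_of_nat_eq)
  have "0 \<le> ?F i mod int Q" "0 \<le> ?F (i + d) mod int Q" using \<open>0 < Q\<close> by auto
  \<comment> \<open>Integrality gains the \<open>- 1\<close>, which absorbs the rounding in the
    difference of two floors.\<close>
  then have "\<bar>v\<bar> \<le> int h - 1" using i unfolding v_def by auto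
  then have v: "\<bar>real_of_int v\<bar> \<le> real h - 1" by linarith
  have "real Q * t * real (i + d) - real Q * t * real i = real Q * (t * real d)"
    by (simp add: algebra_simps)
  then have "\<bar>real Q * (t * real d) - z * real Q\<bar> < real h"
    using eq v by linarith
  moreover have "real Q * (t * real d) - z * real Q = real Q * (t * real d - z)"
    by (simp add: algebra_simps)
  ultimately have "real Q * \<bar>t * real d - z\<bar> < real h" by (simp add: abs_mult)
  moreover have "real Q * int_dist (t * real d) \<le> real Q * \<bar>t * real d - z\<bar>"
    by (intro mult_left_mono int_dist_le) simp
  ultimately show False using gap[OF \<open>d \<in> D\<close>] by linarith
qed

text \<open>Pairs \<open>(q, i)\<close> with \<open>i\<close> in the rotation set of
  \<open>q\<close> are counted twice: each \<open>i < N\<close> has \<open>h\<close> partners, each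
  \<open>q\<close> at most \<open>\<alpha> * N + C\<close>. Division by \<open>N * Q\<close> leaves
  errors \<open>C / N\<close> and \<open>1 / Q\<close>.\<close>

lemma int_dist_bound_if_D_sequences_sparse:
  fixes t \<alpha> :: real
  assumes sparse: "\<And>S N. is_D_sequence D S \<Longrightarrow> real (card (S \<inter> {0..<N})) \<le> \<alpha> * real N + C"
    and gap: "\<And>d. d \<in> D \<Longrightarrow> c \<le> int_dist (t * real d)" and c: "0 \<le> c" "c \<le> 1"
  shows "c \<le> \<alpha>"
proof (rule field_le_epsilon)
  fix \<epsilon> :: real assume "0 < \<epsilon>"
  obtain N :: nat where N: "0 < N" "\<bar>C\<bar> / real N < \<epsilon> / 2"
  proof -
    obtain N :: nat where "2 * \<bar>C\<bar> / \<epsilon> < real N" using reals_Archimedean2 by blast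
    moreover have "0 \<le> 2 * \<bar>C\<bar> / \<epsilon>" using \<open>0 < \<epsilon>\<close> by simp
    ultimately have "0 < real N" by linarith
    with \<open>2 * \<bar>C\<bar> / \<epsilon> < real N\<close> \<open>0 < \<epsilon>\<close> show ?thesis by (intro that[of N]) (auto simp: field_simps)
  qed
  obtain Q :: nat where Q: "0 < Q" "1 / real Q < \<epsilon> / 2"
    using real_arch_inverse[of "\<epsilon> / 2"] \<open>0 < \<epsilon>\<close> by (auto simp: inverse_eq_divide)
  \<comment> \<open>The floor costs at most 1, which becomes the error \<open>1 / Q\<close>.\<close>
  define h where "h = nat \<lfloor>c * real Q\<rfloor>"
  have h: "real h \<le> c * real Q" "c * real Q - 1 \<le> real h"
  proof -
    have "0 \<le> \<lfloor>c * real Q\<rfloor>" using c by simp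
    then have "real h = of_int \<lfloor>c * real Q\<rfloor>" by (simp add: h_def)
    then show "real h \<le> c * real Q" "c * real Q - 1 \<le> real h" by linarith+
  qed
  have "c * real Q \<le> 1 * real Q" using c by (intro mult_right_mono) auto
  then have "h \<le> Q" using h(1) by simp
  let ?S = "\<lambda>q. {i. (q + \<lfloor>real Q * t * real i\<rfloor>) mod int Q < int h}"
  have "real N * real h = (\<Sum>i\<in>{0..<N}. real (card {q \<in> {0..<int Q}. i \<in> ?S q}))"
    using card_residues_shift[OF \<open>h \<le> Q\<close>] by simp
  also have "\<dots> = (\<Sum>i\<in>{0..<N}. \<Sum>q\<in>{0..<int Q}. of_bool (i \<in> ?S q))"
    by (intro sum.cong) (auto simp: Int_def)
  also have "\<dots> = (\<Sum>q\<in>{0..<int Q}. \<Sum>i\<in>{0..<N}. of_bool (i \<in> ?S q))"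
    by (rule sum.swap)
  also have "\<dots> = (\<Sum>q\<in>{0..<int Q}. real (card (?S q \<inter> {0..<N})))"
    by (intro sum.cong) (auto simp: Int_commute)
  also have "\<dots> \<le> (\<Sum>q\<in>{0..<int Q}. \<alpha> * real N + C)"
  proof (intro sum_mono sparse is_D_sequence_rotation \<open>0 < Q\<close>)
    fix d assume "d \<in> D"
    then have "c * real Q \<le> int_dist (t * real d) * real Q" by (intro mult_right_mono gap) auto
    then show "real h \<le> real Q * int_dist (t * real d)" using h by (simp add: mult.commute)
  qed
  also have "\<dots> = real Q * (\<alpha> * real N + C)" by simp
  finally have "real N * (c * real Q - 1) \<le> real Q * (\<alpha> * real N + C)"
    using h(2) N by (smt (verit) mult_left_mono of_nat_0_le_iff)
  then have "c \<le> \<alpha> + C / real N + 1 / real Q"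
    using N Q by (simp add: field_simps)
  moreover have "C / real N \<le> \<bar>C\<bar> / real N" by (intro divide_right_mono) auto
  ultimately show "c \<le> \<alpha> + \<epsilon>" using N Q by linarith
qed

section \<open>Reduction to residues and sparsity\<close>

text \<open>\<open>gap\<close> supplies both lower bounds, through \<open>t = a / M\<close> and the
  residue set; \<open>sparse\<close> supplies both upper bounds.\<close>

lemma kappa_eq_mu_eq_fraction:
  assumes D: "finite D" "D \<noteq> {}" and a: "0 < a" "a \<le> M"
    and gap: "\<And>d z :: int. d \<in> int ` D \<Longrightarrow> int a \<le> \<bar>int a * d - z * int M\<bar>"
    and sparse: "\<And>S N. is_D_sequence D S \<Longrightarrow> real (card (S \<inter> {0..<N})) \<le> real a / real M * real N + C"
  shows "kappa D = mu D \<and> mu D = real a / real M"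
proof -
  let ?m = "\<lambda>t. Min ((\<lambda>d. int_dist (t * real d)) ` D)"
  have Mpos: "0 < M" using a by simp
  have le: "?m t \<le> int_dist (t * real d)" if "d \<in> D" for t d
    using that D by (intro Min_le) auto
  have m0: "0 \<le> ?m t" for t
    using D by (subst Min_ge_iff) (auto simp: int_dist_def)
  have m1: "?m t \<le> 1" for t
  proof -
    obtain d where "d \<in> D" using D by blast
    then show ?thesis using le[of d t] int_dist_le_half[of "t * real d"] by linarith
  qed
  have upper: "?m t \<le> real a / real M" for t
    using sparse le m0 m1 by (rule int_dist_bound_if_D_sequences_sparse)
  have "kappa D = real a / real M"
  proof (rule antisym)
    show "kappa D \<le> real a / real M"
      unfolding kappa_def by (intro cSUP_least upper) simp
    have "real a / real M \<le> int_dist (real a / real M * real d)" if "d \<in> D" for d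
    proof (rule le_int_distI)
      fix z :: int
      have "real a / real M * real d - of_int z = real_of_int (int a * int d - z * int M) / real M"
        using Mpos by (simp add: field_simps)
      then have "\<bar>real a / real M * real d - of_int z\<bar> = real_of_int \<bar>int a * int d - z * int M\<bar> / real M"
        by (simp add: abs_divide)
      moreover have "real_of_int (int a) \<le> real_of_int \<bar>int a * int d - z * int M\<bar>"
        using gap[of "int d" z] \<open>d \<in> D\<close> by (subst of_int_le_iff) auto
      ultimately show "real a / real M \<le> \<bar>real a / real M * real d - of_int z\<bar>"
        by (simp add: divide_right_mono)
    qed
    then have "real a / real M \<le> ?m (real a / real M)"
      using D by (subst Min_ge_iff) auto
    also have "\<dots> \<le> kappa D"
      unfolding kappa_def by (intro cSUP_upper bdd_aboveI2[where M = 1] m1) simp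
    finally show "real a / real M \<le> kappa D" .
  qed
  moreover have "mu D = real a / real M"
    unfolding mu_def
  proof (rule cSup_eq_maximum)
    have "is_D_sequence D {i. a * i mod M < a}" using gap by (rule is_D_sequence_residue_interval)
    with dens_beatty[OF a(2,1)]
    show "real a / real M \<in> {dens S | S. is_D_sequence D S \<and> has_dens S}" by (smt (verit) mem_Collect_eq)
    fix \<delta> assume "\<delta> \<in> {dens S | S. is_D_sequence D S \<and> has_dens S}"
    then obtain S where S: "\<delta> = dens S" "is_D_sequence D S" by blast
    \<comment> \<open>\<open>count_upto S N\<close> ranges over \<open>N + 1\<close> integers, hence
      the instance \<open>Suc N\<close>.\<close>
    have "real (count_upto S N) \<le> real a / real M * (real N + 1) + C" for N
      using sparse[OF S(2), of "Suc N"]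
      by (simp add: count_upto_def atLeastLessThanSuc_atLeastAtMost add.commute)
    then show "\<delta> \<le> real a / real M" unfolding S(1) by (rule dens_le_if_count_le)
  qed
  ultimately show ?thesis by simp
qed


section \<open>Residue criterion and sparse blocks for \<open>{1, j, k}\<close>\<close>

text \<open>If \<open>q \<ge> z\<close>, the difference is at least \<open>r \<ge> a\<close>;
  otherwise it is at most \<open>r - M \<le> - a\<close>.\<close>

lemma le_dist_multiple_if_residue:
  fixes a u M q r z :: int
  assumes "u = q * M + r" "0 \<le> a" "a \<le> r" "r \<le> M - a"
  shows "a \<le> \<bar>u - z * M\<bar>"
proof -
  define v where "v = (q - z) * M"
  have u: "u - z * M = v + r" using assms(1) by (simp add: v_def left_diff_distrib)
  show ?thesis
  proof (cases "0 \<le> q - z")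
    case True
    then have "0 \<le> v" using assms by (simp add: v_def)
    then show ?thesis using assms u by linarith
  next
    case False
    then have "v \<le> - 1 * M" unfolding v_def using assms by (intro mult_right_mono) auto
    then show ?thesis using assms u by linarith
  qed
qed

lemma sum_indicator_eq_card:
  fixes S :: "nat set"
  shows   "(\<Sum>i = a..<b. of_bool (i \<in> S)) = int (card (S \<inter> {a..<b}))"
  by (simp add: Int_commute)

lemma card_le_if_everywhere_sparse_block:
  fixes \<alpha> :: real
  assumes "0 \<le> \<alpha>"
    and "\<And>x. \<exists>l. 0 < l \<and> l \<le> L \<and> real_of_int (\<Sum>i = x..<x + l. of_bool (i \<in> S)) \<le> \<alpha> * real l"
  shows "real (card (S \<inter> {0..<N})) \<le> \<alpha> * real N + real L"
proof -
  have "real_of_int (\<Sum>i = 0..<0 + N. of_bool (i \<in> S)) \<le> \<alpha> * real N + real L"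
    by (rule sum_le_if_everywhere_sparse_block) (use assms in auto)
  then show ?thesis by (simp only: sum_indicator_eq_card add_0_left of_int_of_nat_eq)
qed

lemma card_D_sequence_le:
  fixes n j k :: nat
  assumes S: "is_D_sequence {1, j, k} S" and j: "j = 4 * n + 1"
    and k: "even k" "k \<le> 2 * n * j"
  shows "real (card (S \<inter> {0..<N})) \<le> real n / real (2 * n + 1) * real N + real (k + j + 1)"
proof (rule card_le_if_everywhere_sparse_block)
  fix x
  let ?f = "\<lambda>i. of_bool (i \<in> S) :: int"
  have d: "?f i + ?f (i + 1) \<le> 1" "?f i + ?f (i + j) \<le> 1" "?f i + ?f (i + k) \<le> 1" for i
    using is_D_sequenceD[OF S, of 1 i] is_D_sequenceD[OF S, of j i] is_D_sequenceD[OF S, of k i]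
    by simp_all
  show "\<exists>l. 0 < l \<and> l \<le> k + j + 1 \<and>
      real_of_int (\<Sum>i = x..<x + l. ?f i) \<le> real n / real (2 * n + 1) * real l"
  proof (cases "(\<Sum>i = x..<x + (j + 1). ?f i) \<le> 2 * int n")
    case True
    then have "real_of_int (\<Sum>i = x..<x + (j + 1). ?f i) \<le> real_of_int (2 * int n)"
      by (subst of_int_le_iff)
    \<comment> \<open>Here \<open>j + 1 = 2 * (2 * n + 1)\<close>.\<close>
    also have "\<dots> = real n / real (2 * n + 1) * real (j + 1)"
      using j by (simp add: field_simps)
    finally show ?thesis by (intro exI[of _ "j + 1"]) auto
  next
    case False
    then have "2 * (\<Sum>i = x..<x + (k + j). ?f i) \<le> int k"
      using j k by (intro sum_le_half_if_full[where y = x] d) auto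
    then have "real_of_int (2 * (\<Sum>i = x..<x + (k + j). ?f i)) \<le> real_of_int (int k)"
      by (subst of_int_le_iff)
    then have "2 * real_of_int (\<Sum>i = x..<x + (k + j). ?f i) \<le> real k"
      by (simp only: of_int_mult of_int_numeral of_int_of_nat_eq)
    \<comment> \<open>Clearing denominators turns this into exactly
      \<open>k \<le> 2 * n * j\<close>.\<close>
    moreover have "real k \<le> 2 * (real n / real (2 * n + 1) * real (k + j))"
    proof -
      have "real k \<le> real (2 * n * j)" using k(2) by (simp only: of_nat_le_iff)
      then show ?thesis by (simp add: field_simps)
    qed
    ultimately show ?thesis using j by (intro exI[of _ "k + j"]) auto
  qed
qed simp

lemma sum_pairs_le:
  fixes f :: "nat \<Rightarrow> int"
  assumes "\<And>i. f i + f (i + 1) \<le> 1"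
  shows "(\<Sum>i = x..<x + 2 * r. f i) \<le> int r"
proof (induction r)
  case (Suc r)
  then show ?case using assms[of "x + 2 * r"] by (simp add: add.assoc)
qed simp

lemma sum_blocks_le:
  fixes f :: "nat \<Rightarrow> int"
  assumes "\<And>s. s < m \<Longrightarrow> (\<Sum>i = x + s * l..<x + s * l + l. f i) \<le> c"
  shows "(\<Sum>i = x..<x + m * l. f i) \<le> int m * c"
  using assms
proof (induction m)
  case (Suc m)
  have "(\<Sum>i = x..<x + Suc m * l. f i) = (\<Sum>i = x..<x + m * l. f i) + (\<Sum>i = x + m * l..<x + m * l + l. f i)"
    by (subst sum.atLeastLessThan_concat) (auto simp: ac_simps)
  then show ?case using Suc.IH Suc.prems(1)[of m] Suc.prems by (simp add: algebra_simps)
qed simp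

text \<open>The numerator \<open>2 * n * m + r\<close> counts at most \<open>2 * n\<close> elements
  in each of \<open>m\<close> windows that are not full, at most \<open>r\<close> in the remaining
  \<open>2 * r\<close> places, and none at \<open>x + k\<close> when \<open>x\<close> is in
  \<open>S\<close>.\<close>

lemma card_D_sequence_le_of_small_remainder:
  fixes n m r j k :: nat
  assumes S: "is_D_sequence {1, j, k} S" and j: "j = 4 * n + 1"
    and k: "k = m * (j + 1) + 2 * r" and m: "m < 2 * n"
  shows "real (card (S \<inter> {0..<N})) \<le> real (2 * n * m + r) / real (k + 1) * real N + real (k + j)"
proof (rule card_le_if_everywhere_sparse_block)
  fix x
  let ?f = "\<lambda>i. of_bool (i \<in> S) :: int" and ?a = "2 * n * m + r"
  have d: "?f i + ?f (i + 1) \<le> 1" "?f i + ?f (i + j) \<le> 1" "?f i + ?f (i + k) \<le> 1" for i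
    using is_D_sequenceD[OF S, of 1 i] is_D_sequenceD[OF S, of j i] is_D_sequenceD[OF S, of k i]
    by simp_all
  have "even k" using j k by simp
  consider "x \<notin> S" | "(\<Sum>i = x..<x + (k + 1). ?f i) \<le> int ?a"
    | s where "s < m" "2 * int n < (\<Sum>i = x + s * (j + 1)..<x + s * (j + 1) + (j + 1). ?f i)"
  proof (cases "x \<in> S \<and> (\<forall>s<m. (\<Sum>i = x + s * (j + 1)..<x + s * (j + 1) + (j + 1). ?f i) \<le> 2 * int n)")
    case True
    then have "?f (x + k) = 0" using d(3)[of x] by (auto simp: of_bool_def split: if_splits)
    moreover have "(\<Sum>i = x..<x + m * (j + 1). ?f i) \<le> int m * (2 * int n)"
      using True by (intro sum_blocks_le) blast
    moreover have "(\<Sum>i = x + m * (j + 1)..<x + m * (j + 1) + 2 * r. ?f i) \<le> int r"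
      by (intro sum_pairs_le d)
    moreover have "(\<Sum>i = x..<x + (k + 1). ?f i)
        = (\<Sum>i = x..<x + m * (j + 1). ?f i) + (\<Sum>i = x + m * (j + 1)..<x + m * (j + 1) + 2 * r. ?f i)
          + ?f (x + k)"
    proof -
      have "(\<Sum>i = x..<x + (k + 1). ?f i) = (\<Sum>i = x..<x + k. ?f i) + ?f (x + k)"
        by (simp del: sum_of_bool_eq)
      then show ?thesis
        by (subst sum.atLeastLessThan_concat) (auto simp: k add.assoc simp del: sum_of_bool_eq)
    qed
    ultimately have "(\<Sum>i = x..<x + (k + 1). ?f i) \<le> int ?a" by (simp add: algebra_simps del: sum_of_bool_eq)
    then show ?thesis by (rule that(2))
  qed (use that in force)
  then show "\<exists>l. 0 < l \<and> l \<le> k + j \<and>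
      real_of_int (\<Sum>i = x..<x + l. ?f i) \<le> real ?a / real (k + 1) * real l"
  proof cases
    case 1
    then show ?thesis using j by (intro exI[of _ 1]) auto
  next
    case 2
    then have "real_of_int (\<Sum>i = x..<x + (k + 1). ?f i) \<le> real_of_int (int ?a)"
      by (subst of_int_le_iff)
    then show ?thesis using j by (intro exI[of _ "k + 1"]) auto
  next
    case 3
    \<comment> \<open>The full window thus starts at most \<open>k\<close> beyond \<open>x\<close>,
      at an even offset since \<open>j + 1\<close> is even.\<close>
    have "Suc s * (j + 1) \<le> m * (j + 1)" using 3(1) by (intro mult_right_mono) auto
    then have "2 * (\<Sum>i = x..<x + (k + j). ?f i) \<le> int k"
      using j \<open>even k\<close> k 3(2) by (intro sum_le_half_if_full[where y = "x + s * (j + 1)"] d) auto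
    then have "real_of_int (2 * (\<Sum>i = x..<x + (k + j). ?f i)) \<le> real_of_int (int k)"
      by (subst of_int_le_iff)
    then have "2 * real_of_int (\<Sum>i = x..<x + (k + j). ?f i) \<le> real k"
      by (simp only: of_int_mult of_int_numeral of_int_of_nat_eq)
    \<comment> \<open>With \<open>2 * ?a = k - 2 * m\<close>, the claim becomes
      \<open>2 * m * j \<le> k * (4 * n - 2 * m)\<close>. It holds since
      \<open>m * j \<le> k\<close> and \<open>m < 2 * n\<close> makes the last factor at least
      2.\<close>
    moreover have "real k \<le> 2 * (real ?a / real (k + 1) * real (k + j))"
    proof -
      have a: "2 * ?a + 2 * m = k" by (simp add: k j algebra_simps)
      have "int k * 2 \<le> int k * (4 * int n - 2 * int m)"
        using m by (intro mult_left_mono) auto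
      moreover have "m * j \<le> k" by (simp add: k)
      then have "int m * int j \<le> int k" by (metis of_nat_le_iff of_nat_mult)
      moreover have "(2 * int ?a) * (int k + int j) - int k * (int k + 1)
          = int k * (4 * int n - 2 * int m) - 2 * (int m * int j)"
      proof -
        have *: "2 * int ?a = int k - 2 * int m" using a by linarith
        show ?thesis unfolding * by (simp add: j algebra_simps)
      qed
      ultimately have "int k * (int k + 1) \<le> (2 * int ?a) * (int k + int j)" by linarith
      then have "int (k * (k + 1)) \<le> int (2 * ?a * (k + j))"
        by (simp only: of_nat_mult of_nat_add of_nat_numeral of_nat_1)
      then have "real (k * (k + 1)) \<le> real (2 * ?a * (k + j))" by (simp only: of_nat_le_iff)
      then have "real k * real (k + 1) \<le> 2 * real ?a * real (k + j)" by (simp only: of_nat_mult of_nat_numeral)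
      then show ?thesis by (simp add: pos_le_divide_eq del: of_nat_add of_nat_mult of_nat_Suc)
    qed
    ultimately show ?thesis using j by (intro exI[of _ "k + j"]) auto
  qed
qed simp

section \<open>Residues in the two cases\<close>

theorem theorem1:
  fixes n j k m kbar :: nat and D :: "nat set"
  assumes "n \<ge> 1"
    and "j = 4 * n + 1"
    and "even k" and "k > 0"
    and "real k \<le> real j * (real j - 1) / 2"
    and "D = {1, j, k}"
    and "k = m * (j + 1) + kbar" and "kbar \<le> j"
  shows "(kbar = 2 * n \<or> kbar = 2 * n + 2 \<longrightarrow>
            kappa D = mu D \<and> mu D = real n / (2 * real n + 1))
       \<and> (max 0 (2 * (int n - int m)) \<le> int kbar \<and> int kbar \<le> 2 * (int n - 1) \<longrightarrow>
            kappa D = mu D \<and> mu D = (real k - 2 * real m) / (2 * (real k + 1)))"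
proof -
  have D: "finite D" "D \<noteq> {}" "int ` D = {1, int j, int k}" using assms(6) by auto
  have kj: "k \<le> 2 * n * j"
  proof -
    have "real k \<le> real (2 * n * j)" using assms(5) by (simp add: assms(2) field_simps)
    then show ?thesis by (simp only: of_nat_le_iff)
  qed
  have "kappa D = mu D \<and> mu D = real n / real (2 * n + 1)" if kbar: "kbar = 2 * n \<or> kbar = 2 * n + 2"
  proof (rule kappa_eq_mu_eq_fraction[OF D(1,2)])
    fix d z :: int assume "d \<in> int ` D"
    \<comment> \<open>Modulo \<open>2 * n + 1\<close> only the residues \<open>n\<close> and
      \<open>n + 1\<close>, that is \<open>n\<close> and \<open>- n\<close>, are admissible. Since
      \<open>j + 1\<close> is a multiple of the modulus, \<open>j\<close> is -1 and \<open>k\<close>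
      is congruent to \<open>kbar\<close>, which is -1 or 1.\<close>
    then consider "d = 1" | "d = int j" | "d = int k" "kbar = 2 * n" | "d = int k" "kbar = 2 * n + 2"
      using D(3) kbar by auto
    then show "int n \<le> \<bar>int n * d - z * int (2 * n + 1)\<bar>"
    proof cases
      case 1
      then show ?thesis by (intro le_dist_multiple_if_residue[where q = 0 and r = "int n"]) auto
    next
      case 2
      then show ?thesis
        by (intro le_dist_multiple_if_residue[where q = "2 * int n - 1" and r = "int n + 1"])
           (auto simp: assms(2) algebra_simps)
    next
      case 3
      then show ?thesis
        by (intro le_dist_multiple_if_residue[where q = "2 * int n * int m + int n - 1" and r = "int n + 1"])
           (auto simp: assms(2,7) algebra_simps)
    next
      case 4
      then show ?thesis
        by (intro le_dist_multiple_if_residue[where q = "2 * int n * int m + int n" and r = "int n"])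
           (auto simp: assms(2,7) algebra_simps)
    qed
  next
    fix S N assume "is_D_sequence D S"
    then show "real (card (S \<inter> {0..<N})) \<le> real n / real (2 * n + 1) * real N + real (k + j + 1)"
      using card_D_sequence_le[OF _ assms(2,3) kj] assms(6) by simp
  qed (use assms(1) in auto)
  moreover have "kappa D = mu D \<and> mu D = (real k - 2 * real m) / (2 * (real k + 1))"
    if kbar: "max 0 (2 * (int n - int m)) \<le> int kbar" "int kbar \<le> 2 * (int n - 1)"
  proof -
    have "even kbar" using assms(2,3,7) by simp
    then obtain r where r: "kbar = 2 * r" by blast
    have kr: "k = m * (j + 1) + 2 * r" using assms(7) r by simp
    have m: "m < 2 * n"
    proof (rule ccontr)
      assume "\<not> m < 2 * n"
      then have "2 * n * (j + 1) \<le> m * (j + 1)" by (intro mult_right_mono) auto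
      then show False using kj kr assms(1) by (simp add: algebra_simps)
    qed
    have nmr: "n \<le> m + r" "r + 1 \<le> n" using kbar r by auto
    define a where "a = 2 * n * m + r"
    have ak: "2 * a + 2 * m = k" by (simp add: a_def kr assms(2) algebra_simps)
    \<comment> \<open>For \<open>m = 0\<close> the two bounds in \<open>nmr\<close> contradict each
      other.\<close>
    have "0 < a" using assms(1) nmr by (cases "m = 0") (auto simp: a_def)
    have "kappa D = mu D \<and> mu D = real a / real (k + 1)"
    proof (rule kappa_eq_mu_eq_fraction[OF D(1,2)])
      fix d z :: int assume "d \<in> int ` D"
      then consider "d = 1" | "d = int j" | "d = int k" using D(3) by auto
      then show "int a \<le> \<bar>int a * d - z * int (k + 1)\<bar>"
      proof cases
        case 1
        then show ?thesis using ak by (intro le_dist_multiple_if_residue[where q = 0 and r = "int a"]) auto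
      next
        case 2
        have a: "int a = 2 * int n * int m + int r" and k: "int k = 4 * int n * int m + 2 * int m + 2 * int r"
          by (simp_all add: a_def kr assms(2) algebra_simps)
        show ?thesis unfolding 2
        proof (rule le_dist_multiple_if_residue)
          \<comment> \<open>The residue is at least \<open>a\<close> because
            \<open>n \<le> m + r\<close>, and at most \<open>k + 1 - a\<close> because
            \<open>r \<le> n\<close>: the two bounds on \<open>kbar\<close>.\<close>
          show "int a * int j = (2 * int n - 1) * int (k + 1) + (int a + 2 * int m + 1 + 2 * int r - 2 * int n)"
            by (simp add: a k assms(2) algebra_simps)
        qed (use nmr ak in auto)
      next
        case 3
        \<comment> \<open>Modulo \<open>k + 1\<close>, \<open>k\<close> is -1, so
          \<open>a * k\<close> has residue \<open>k + 1 - a\<close>.\<close>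
        then show ?thesis using ak
          by (intro le_dist_multiple_if_residue[where q = "int a - 1" and r = "int (k + 1) - int a"])
             (auto simp: algebra_simps)
      qed
    next
      fix S N assume "is_D_sequence D S"
      then show "real (card (S \<inter> {0..<N})) \<le> real a / real (k + 1) * real N + real (k + j)"
        using card_D_sequence_le_of_small_remainder[OF _ assms(2) kr m] assms(6) unfolding a_def by simp
    qed (use ak \<open>0 < a\<close> in auto)
    moreover have "real a / real (k + 1) = (real k - 2 * real m) / (2 * (real k + 1))"
    proof -
      have "real k - 2 * real m = 2 * real a" using ak by (simp flip: ak)
      then show ?thesis by (simp only: mult_divide_mult_cancel_left_if) simp
    qed
    ultimately show ?thesis by simp
  qed
  ultimately show ?thesis by (simp add: add.commute)
qed

end
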